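(* Let $(\mathcal D_n)_{n\ge1}$ be a sequence of feasible degree sequences and let $d=d(n)$. Fix any $p=p(n)\in(0,1]$ with $p\ll1/d$ such that $p\,d(S_n(d))\gg1$, and let $\omega=\omega(n)=\min\{(dp)^{-1},\,p\,d(S_n(d))\}$. For any (deterministic) graph $G$ with vertex set $[n]$ and degree sequence $\mathcal D_n$, $$\mathbb P\left[L_1(G_p)\le\max\left\{|S_n(d)|+(1+2\omega^{-1/3})\,p\,d(S_n(d)),\ 2\,\frac{\log n}{\log\omega}\right\}\right]=1-o(1).$$
   Context: For each $n$, $\mathcal D_n$ is a sequence of $n$ integers, each $\ge1$, that is feasible, i.e. there is a simple graph on $[n]$ with this degree sequence; $d(v)$ denotes the prescribed degree of $v\in[n]$. All graphs are simple. For a graph $G$ and $p\in[0,1]$, $G_p$ is the random subgraph on the same vertex set in which each edge of $G$ is kept independently with probability $p$. $L_1(G)$ is the number of vertices of a largest component of $G$. $S_n(x)=\{v\in[n]:d(v)\ge x\}$, and $d(S)=\sum_{v\in S}d(v)$ for a vertex set $S$. Asymptotics are as $n\to\infty$; $f\ll g$ (equivalently $g\gg f$) means $f(n)/g(n)\to0$. *)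

theory Defs
  imports "HOL-Probability.Probability" "HOL-Library.Landau_Symbols"
begin

text \<open>A graph on a vertex set \<open>V\<close> is represented by its edge set, each edge being the
  two-element set of its endpoints.\<close>

definition simple_graph :: "'a set \<Rightarrow> 'a set set \<Rightarrow> bool" where
  "simple_graph V E \<longleftrightarrow> (\<forall>e\<in>E. e \<subseteq> V \<and> card e = 2)"

definition degree :: "'a set set \<Rightarrow> 'a \<Rightarrow> nat" where
  "degree E v = card {e \<in> E. v \<in> e}"

definition has_degrees :: "'a set \<Rightarrow> 'a set set \<Rightarrow> ('a \<Rightarrow> nat) \<Rightarrow> bool" where
  "has_degrees V E D \<longleftrightarrow> (\<forall>v\<in>V. degree E v = D v)"

definition feasible :: "nat \<Rightarrow> (nat \<Rightarrow> nat) \<Rightarrow> bool" where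
  "feasible n D \<longleftrightarrow> (\<exists>E. simple_graph {1..n} E \<and> has_degrees {1..n} E D)"

definition component_of :: "'a set set \<Rightarrow> 'a \<Rightarrow> 'a set" where
  "component_of E v = {w. (v, w) \<in> {(x, y). {x, y} \<in> E}\<^sup>*}"

definition L1 :: "'a set \<Rightarrow> 'a set set \<Rightarrow> nat" where
  "L1 V E = Max ((\<lambda>v. card (component_of E v)) ` V)"

text \<open>Bond percolation; it is meaningful only for a finite edge set and \<open>0 \<le> p \<le> 1\<close>.\<close>

definition random_subgraph :: "'a set set \<Rightarrow> real \<Rightarrow> 'a set set pmf" where
  "random_subgraph E p =
     map_pmf (\<lambda>f. {e \<in> E. f e}) (Pi_pmf E False (\<lambda>_. bernoulli_pmf p))"

definition high_degree :: "nat \<Rightarrow> (nat \<Rightarrow> nat) \<Rightarrow> real \<Rightarrow> nat set" where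
  "high_degree n D x = {v \<in> {1..n}. real (D v) \<ge> x}"

definition degree_sum :: "('a \<Rightarrow> nat) \<Rightarrow> 'a set \<Rightarrow> nat" where
  "degree_sum D S = (\<Sum>v\<in>S. D v)"

end

theory Submission
  imports Defs
begin

text \<open>
  Call the vertices of \<open>S = S\<^sub>n(d)\<close> high and the others low, and put \<open>\<mu> = p d(S)\<close> and
  \<open>\<rho> = dp \<le> 1/\<omega>\<close>. A low vertex has fewer than \<open>d\<close> neighbours, so an exploration of the
  percolated graph that passes only through low vertices has on average at most \<open>\<rho> \<ll> 1\<close>
  children per vertex. A component either meets \<open>S\<close> or consists of low vertices, and the two
  terms of the maximum bound these two kinds of component.

  All components that meet \<open>S\<close> lie in \<open>S\<close> together with the low vertices explored from \<open>S\<close>. At most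
  \<open>d(S)\<close> edges touch \<open>S\<close>; by Chebyshev's inequality, more than \<open>(1 + \<delta>) \<mu>\<close> of them are kept
  with probability at most \<open>1/(\<delta>\<^sup>2 \<mu>)\<close>, and this controls the vertices next to \<open>S\<close>. The
  low vertices beyond these number at most \<open>\<mu> \<rho> / (1 - \<rho>)\<close> on average
  (\<open>mean_reach\<close>, \<open>mean_far\<close>), so Markov's inequality is enough for them: they exceed \<open>\<delta> \<mu>\<close> with
  probability at most \<open>\<rho> / (\<delta> (1 - \<rho>))\<close>. The choice \<open>\<delta> = \<omega>\<^sup>-\<^sup>1\<^sup>/\<^sup>3\<close> makes both errors \<open>O(\<delta>)\<close>.

  A given low vertex explores \<open>j\<close> further low vertices with probability at most \<open>2 (4 \<rho>)\<^sup>j\<close>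
  (\<open>prob_reach_ge\<close>, a union bound over exploration trees). Summed over all vertices this is at most
  \<open>2 n (4 / \<omega>)\<^sup>j\<close>, and for \<open>j = \<lfloor>2 log n / log \<omega>\<rfloor>\<close> it tends to zero (\<open>subcritical_tail\<close>).
  This needs \<open>\<omega> \<le> n\<close>, but for \<open>\<omega> > n\<close> the bound is trivial, because \<open>\<mu> \<ge> \<omega>\<close>.

  Independence of the edges enters only through \<open>P(F \<subseteq> G\<^sub>p) = p\<^sup>|\<^sup>F\<^sup>|\<close>: the estimates carry along a
  set \<open>F\<close> of edges that are required to be present, and enlarge it edge by edge.
\<close>

section \<open>Exploration of a graph\<close>

text \<open>The vertices outside \<open>X\<close> that can be reached from \<open>A\<close> by a walk in \<open>H\<close> that stays outside
  \<open>X\<close> after its first vertex. In the estimates \<open>X\<close> is the set of vertices already seen, including all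
  high ones, and \<open>A \<subseteq> X\<close> the set of seen vertices whose neighbourhoods are still to be explored.\<close>

inductive_set reach :: "'a set set \<Rightarrow> 'a set \<Rightarrow> 'a set \<Rightarrow> 'a set" for H A X where
  start: "a \<in> A \<Longrightarrow> {a, b} \<in> H \<Longrightarrow> b \<notin> X \<Longrightarrow> b \<in> reach H A X"
| step: "a \<in> reach H A X \<Longrightarrow> {a, b} \<in> H \<Longrightarrow> b \<notin> X \<Longrightarrow> b \<in> reach H A X"

lemma simple_graph_subset: "simple_graph V E \<Longrightarrow> H \<subseteq> E \<Longrightarrow> simple_graph V H"
  by (auto simp: simple_graph_def)

lemma simple_graph_edgeD: "simple_graph V E \<Longrightarrow> {a, b} \<in> E \<Longrightarrow> a \<in> V \<and> b \<in> V \<and> a \<noteq> b"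
  unfolding simple_graph_def by (cases "a = b") auto

lemma finite_simple_graph: "finite V \<Longrightarrow> simple_graph V E \<Longrightarrow> finite E"
  by (rule finite_subset[of _ "Pow V"]) (auto simp: simple_graph_def)

lemma reach_subset:
  assumes g: "simple_graph V H"
  shows "reach H A X \<subseteq> V - X"
proof
  fix b assume "b \<in> reach H A X"
  then show "b \<in> V - X" by induction (use simple_graph_edgeD[OF g] in auto)
qed

lemma finite_reach: "finite V \<Longrightarrow> simple_graph V H \<Longrightarrow> finite (reach H A X)"
  by (rule finite_subset[OF reach_subset]) auto

lemma reach_empty: "reach H {} X = {}"
proof -
  have "b \<in> reach H {} X \<Longrightarrow> False" for b by (induction rule: reach.induct) auto
  then show ?thesis by blast
qed

lemma reach_least:
  assumes "\<And>a b. a \<in> A \<Longrightarrow> {a, b} \<in> H \<Longrightarrow> b \<notin> X \<Longrightarrow> b \<in> C"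
    and "\<And>a b. a \<in> C \<Longrightarrow> {a, b} \<in> H \<Longrightarrow> b \<notin> X \<Longrightarrow> b \<in> C"
  shows "reach H A X \<subseteq> C"
proof
  fix b assume "b \<in> reach H A X"
  then show "b \<in> C" by (induction rule: reach.induct) (use assms in blast)+
qed

text \<open>A walk that returns to its first new vertex \<open>b\<close> can be cut there, so after the step to \<open>b\<close>
  this vertex may be forbidden. This is what makes edges used later on new, and so independent of the
  edge to \<open>b\<close>.\<close>

lemma reach_by_first_vertex:
  "reach H A X \<subseteq> (\<Union>a\<in>A. \<Union>b\<in>{b. b \<notin> X \<and> {a, b} \<in> H}. insert b (reach H {b} (insert b X)))"
  (is "_ \<subseteq> ?C")
proof (rule reach_least)
  fix a b assume "a \<in> ?C" "{a, b} \<in> H" "b \<notin> X"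
  then obtain a' b' where *: "a' \<in> A" "b' \<notin> X" "{a', b'} \<in> H"
      "a \<in> insert b' (reach H {b'} (insert b' X))" by blast
  have "b \<in> insert b' (reach H {b'} (insert b' X))"
  proof (cases "b = b'")
    case False
    then show ?thesis using *(4) \<open>{a, b} \<in> H\<close> \<open>b \<notin> X\<close>
      by (auto intro: reach.start reach.step)
  qed simp
  then show "b \<in> ?C" using * by blast
qed blast

text \<open>The first of the two moves in an exploration: an active vertex with no unseen neighbour is
  dropped. The second one, \<open>reach_reveal\<close>, marks an unseen vertex as seen and active.\<close>

lemma reach_skip:
  assumes "\<And>b. {a, b} \<in> H \<Longrightarrow> b \<in> X"
  shows "reach H (insert a A) X \<subseteq> reach H A X"
proof (rule reach_least)
  fix b c assume "b \<in> insert a A" "{b, c} \<in> H" "c \<notin> X"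
  then show "c \<in> reach H A X" using assms reach.start[of b A c H X] by blast
next
  fix b c assume "b \<in> reach H A X" "{b, c} \<in> H" "c \<notin> X"
  then show "c \<in> reach H A X" by (rule reach.step)
qed

lemma reach_reveal:
  "reach H A X \<subseteq> insert b (reach H (insert b A) (insert b X))"
  (is "_ \<subseteq> insert b ?R")
proof (rule reach_least)
  fix c e assume "c \<in> A" "{c, e} \<in> H" "e \<notin> X"
  then show "e \<in> insert b ?R" using reach.start[of c "insert b A" e H "insert b X"] by blast
next
  fix c e assume "c \<in> insert b ?R" "{c, e} \<in> H" "e \<notin> X"
  then show "e \<in> insert b ?R"
    using reach.start[of b "insert b A" e H "insert b X"]
      reach.step[of c H "insert b A" "insert b X" e] by blast
qed

lemma sym_adjacency: "sym {(x, y). {x, y} \<in> (H :: 'a set set)}"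
  by (auto simp: sym_def insert_commute)

lemma component_of_closed:
  assumes "v \<in> C" "\<And>a b. a \<in> C \<Longrightarrow> {a, b} \<in> H \<Longrightarrow> b \<in> C"
  shows "component_of H v \<subseteq> C"
proof
  fix w assume "w \<in> component_of H v"
  then have "(v, w) \<in> {(x, y). {x, y} \<in> H}\<^sup>*" by (simp add: component_of_def)
  then show "w \<in> C" by induction (use assms in auto)
qed

text \<open>By symmetry a vertex of \<open>S\<close> in the component of \<open>v\<close> also leads to \<open>v\<close>, and
  \<open>S \<union> reach H S S\<close> is closed under adjacency. The bound is thus the same for all components that meet
  \<open>S\<close>.\<close>

lemma component_of_meets:
  assumes "component_of H v \<inter> S \<noteq> {}"
  shows "component_of H v \<subseteq> S \<union> reach H S S"
proof -
  let ?R = "{(x, y). {x, y} \<in> H}\<^sup>*"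
  have closed: "b \<in> S \<union> reach H S S" if "a \<in> S \<union> reach H S S" "{a, b} \<in> H" for a b
    using that by (auto intro: reach.start reach.step)
  obtain s where s: "s \<in> S" "(v, s) \<in> ?R" using assms by (auto simp: component_of_def)
  have "(s, v) \<in> ?R" using s(2) sym_rtrancl[OF sym_adjacency[of H]] by (meson symD)
  then have "v \<in> component_of H s" by (simp add: component_of_def)
  then have "v \<in> S \<union> reach H S S"
    using component_of_closed[of s "S \<union> reach H S S" H] s(1) closed by blast
  then show ?thesis using component_of_closed[of v "S \<union> reach H S S" H] closed by blast
qed

lemma component_of_avoids:
  assumes "component_of H v \<inter> S = {}"
  shows "component_of H v \<subseteq> insert v (reach H {v} (insert v S))"
proof
  fix w assume "w \<in> component_of H v"
  then have "(v, w) \<in> {(x, y). {x, y} \<in> H}\<^sup>*" by (simp add: component_of_def)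
  then show "w \<in> insert v (reach H {v} (insert v S))"
  proof induction
    case (step y z)
    then have "z \<in> component_of H v" unfolding component_of_def by (blast intro: rtrancl_into_rtrancl)
    then have "z \<notin> S" using assms by blast
    then show ?case using step by (auto intro: reach.start reach.step)
  qed simp
qed

lemma card_neighbours_le_degree:
  assumes "finite E"
  shows "card {b. {a, b} \<in> E} \<le> degree E a"
proof -
  have "inj_on (\<lambda>b. {a, b}) {b. {a, b} \<in> E}" by (auto simp: inj_on_def doubleton_eq_iff)
  moreover have "(\<lambda>b. {a, b}) ` {b. {a, b} \<in> E} \<subseteq> {e \<in> E. a \<in> e}" by auto
  ultimately show ?thesis unfolding degree_def
    by (rule card_inj_on_le) (use assms in simp)
qed

text \<open>An edge that touches \<open>S\<close> has at most one endpoint outside \<open>S\<close>.\<close>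

lemma card_boundary:
  assumes "finite V" "simple_graph V H"
  shows "card {b. b \<notin> S \<and> (\<exists>s\<in>S. {s, b} \<in> H)} \<le> card {e \<in> H. e \<inter> S \<noteq> {}}"
proof -
  let ?T = "{e \<in> H. e \<inter> S \<noteq> {}}"
  have fin: "finite ?T" using finite_simple_graph[OF assms] by simp
  have one: "finite (e - S) \<and> card (e - S) \<le> 1" if "e \<in> ?T" for e
  proof -
    have "card e = 2" using that assms(2) by (auto simp: simple_graph_def)
    then have fe: "finite e" by (metis card.infinite zero_neq_numeral)
    have "e - S \<subset> e" using that by auto
    then have "card (e - S) < card e" using fe psubset_card_mono by blast
    then show ?thesis using fe \<open>card e = 2\<close> by simp
  qed
  have "{b. b \<notin> S \<and> (\<exists>s\<in>S. {s, b} \<in> H)} \<subseteq> (\<Union>e\<in>?T. e - S)" by blast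
  then have "card {b. b \<notin> S \<and> (\<exists>s\<in>S. {s, b} \<in> H)} \<le> card (\<Union>e\<in>?T. e - S)"
    by (rule card_mono[rotated]) (intro finite_UN_I fin, use one in blast)
  also have "\<dots> \<le> (\<Sum>e\<in>?T. card (e - S))" by (rule card_UN_le[OF fin])
  also have "\<dots> \<le> (\<Sum>e\<in>?T. 1)" by (rule sum_mono) (use one in blast)
  finally show ?thesis by simp
qed

lemma card_edges_touching:
  assumes "finite E" "finite S"
  shows "card {e \<in> E. e \<inter> S \<noteq> {}} \<le> degree_sum (degree E) S"
proof -
  have "{e \<in> E. e \<inter> S \<noteq> {}} = (\<Union>s\<in>S. {e \<in> E. s \<in> e})" by blast
  then show ?thesis unfolding degree_sum_def degree_def using card_UN_le[OF assms(2)] by metis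
qed

section \<open>Moments of bond percolation\<close>

abbreviation mean :: "'a set set \<Rightarrow> real \<Rightarrow> ('a set set \<Rightarrow> real) \<Rightarrow> real" where
  "mean E p f \<equiv> measure_pmf.expectation (random_subgraph E p) f"

lemma set_random_subgraph: "set_pmf (random_subgraph E p) \<subseteq> Pow E"
  by (auto simp: random_subgraph_def)

lemma mean_integrable:
  "finite E \<Longrightarrow> integrable (measure_pmf (random_subgraph E p)) (f :: _ \<Rightarrow> real)"
  by (rule integrable_measure_pmf_finite) (meson finite_Pow_iff finite_subset set_random_subgraph)

lemma mean_mono:
  assumes "finite E" "\<And>H. H \<subseteq> E \<Longrightarrow> f H \<le> g H"
  shows "mean E p f \<le> mean E p g"
  by (rule integral_mono_AE) (use assms set_random_subgraph[of E p] in
      \<open>auto intro: mean_integrable simp: AE_measure_pmf_iff\<close>)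

lemma mean_add: "finite E \<Longrightarrow> mean E p (\<lambda>H. f H + g H) = mean E p f + mean E p g"
  by (intro Bochner_Integration.integral_add mean_integrable)

lemma mean_sum: "finite E \<Longrightarrow> mean E p (\<lambda>H. \<Sum>b\<in>B. f b H) = (\<Sum>b\<in>B. mean E p (f b))"
  by (intro Bochner_Integration.integral_sum mean_integrable)

lemma prob_eq_mean:
  "measure_pmf.prob (random_subgraph E p) {H. P H} = mean E p (\<lambda>H. of_bool (P H))"
proof -
  have "mean E p (\<lambda>H. of_bool (P H)) = mean E p (indicator {H. P H})"
    by (rule Bochner_Integration.integral_cong) (auto simp: indicator_def)
  then show ?thesis by simp
qed

lemma mean_edges_kept:
  assumes "finite E" "F \<subseteq> E" "0 \<le> p" "p \<le> 1"
  shows "mean E p (\<lambda>H. of_bool (F \<subseteq> H)) = p ^ card F"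
proof -
  let ?A = "\<lambda>e. if e \<in> F then {True} else UNIV"
  have "mean E p (\<lambda>H. of_bool (F \<subseteq> H)) = measure_pmf.prob (random_subgraph E p) {H. F \<subseteq> H}"
    by (simp only: prob_eq_mean)
  also have "\<dots> = measure_pmf.prob (Pi_pmf E False (\<lambda>_. bernoulli_pmf p)) {f. \<forall>e\<in>F. f e}"
    unfolding random_subgraph_def using assms(2) by (auto simp: vimage_def intro!: arg_cong2[where f = measure])
  also have "{f. \<forall>e\<in>F. f e} = Pi E ?A"
    using assms(2) by (auto simp: Pi_def split: if_splits)
  also have "measure_pmf.prob (Pi_pmf E False (\<lambda>_. bernoulli_pmf p)) (Pi E ?A)
      = (\<Prod>e\<in>E. measure_pmf.prob (bernoulli_pmf p) (?A e))"
    by (rule measure_Pi_pmf_Pi[OF assms(1)])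
  also have "\<dots> = (\<Prod>e\<in>E. if e \<in> F then p else 1)"
    using assms(3,4) by (intro prod.cong) (auto simp: measure_pmf_single)
  also have "\<dots> = p ^ card F"
    using assms(1,2) by (simp add: prod.If_cases Int_absorb1)
  finally show ?thesis .
qed

text \<open>The indicators of distinct edges are uncorrelated, because a pair of edges is kept with
  probability \<open>p\<^sup>2\<close>; only the diagonal of the double sum survives.\<close>

lemma variance_edges_kept:
  assumes "finite E" "T \<subseteq> E" "0 \<le> p" "p \<le> 1"
  shows "mean E p (\<lambda>H. (real (card (H \<inter> T)) - real (card T) * p)\<^sup>2) = real (card T) * (p * (1 - p))"
proof -
  have finT: "finite T" using assms(1,2) finite_subset by blast
  have one: "mean E p (\<lambda>H. of_bool (e \<in> H)) = p" if "e \<in> T" for e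
    using mean_edges_kept[of E "{e}" p] that assms by auto
  have cov: "mean E p (\<lambda>H. (of_bool (e \<in> H) - p) * (of_bool (f \<in> H) - p)) = of_bool (e = f) * (p * (1 - p))"
    if "e \<in> T" "f \<in> T" for e f
  proof -
    have "mean E p (\<lambda>H. (of_bool (e \<in> H) - p) * (of_bool (f \<in> H) - p))
        = mean E p (\<lambda>H. of_bool ({e, f} \<subseteq> H) - p * of_bool (e \<in> H) - p * of_bool (f \<in> H) + p * p)"
      by (rule Bochner_Integration.integral_cong) (auto simp: algebra_simps)
    also have "\<dots> = mean E p (\<lambda>H. of_bool ({e, f} \<subseteq> H)) - p * p - p * p + p * p"
      by (simp add: mean_integrable[OF assms(1)] one that)
    also have "mean E p (\<lambda>H. of_bool ({e, f} \<subseteq> H)) = p ^ card {e, f}"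
      by (rule mean_edges_kept) (use that assms in auto)
    finally show ?thesis by (cases "e = f") (auto simp: algebra_simps power2_eq_square)
  qed
  have "real (card (H \<inter> T)) - real (card T) * p = (\<Sum>e\<in>T. of_bool (e \<in> H) - p)" for H
    using finT by (simp add: sum_subtractf Int_commute Int_def)
  then have "mean E p (\<lambda>H. (real (card (H \<inter> T)) - real (card T) * p)\<^sup>2)
      = mean E p (\<lambda>H. \<Sum>e\<in>T. \<Sum>f\<in>T. (of_bool (e \<in> H) - p) * (of_bool (f \<in> H) - p))"
    by (simp add: power2_eq_square sum_product)
  also have "\<dots> = (\<Sum>e\<in>T. \<Sum>f\<in>T. of_bool (e = f) * (p * (1 - p)))"
    by (simp add: mean_sum assms(1) cov)
  also have "\<dots> = (\<Sum>e\<in>T. p * (1 - p))"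
  proof (rule sum.cong[OF refl])
    fix e assume "e \<in> T"
    have "(\<Sum>f\<in>T. of_bool (e = f) * (p * (1 - p))) = (\<Sum>f\<in>T. if e = f then p * (1 - p) else 0)"
      by (rule sum.cong) auto
    then show "(\<Sum>f\<in>T. of_bool (e = f) * (p * (1 - p))) = p * (1 - p)"
      using finT \<open>e \<in> T\<close> by simp
  qed
  finally show ?thesis by simp
qed

text \<open>\<open>S\<close> plays the role of the set of high-degree vertices: only outside it is \<open>\<Delta>\<close> a bound on the
  degrees.\<close>

locale percolation =
  fixes V S :: "'a set" and E :: "'a set set" and p \<Delta> :: real
  assumes finite_V: "finite V" and simple: "simple_graph V E" and S_subset: "S \<subseteq> V"
    and p_bounds: "0 \<le> p" "p \<le> 1"
    and \<Delta>_nonneg: "0 \<le> \<Delta>"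
    and low_degree: "\<And>v. v \<in> V - S \<Longrightarrow> real (degree E v) \<le> \<Delta>"
begin

text \<open>\<open>\<rho>\<close> bounds the mean number of children of a low vertex in the exploration, and \<open>\<mu>\<close> the
  mean number of kept edges that touch \<open>S\<close>.\<close>

abbreviation "\<rho> \<equiv> \<Delta> * p"
abbreviation "\<mu> \<equiv> p * real (degree_sum (degree E) S)"

lemma rho_nonneg: "0 \<le> \<rho>" using \<Delta>_nonneg p_bounds by simp

lemma finite_E: "finite E" using finite_simple_graph finite_V simple by blast

lemma simple_sub: "H \<subseteq> E \<Longrightarrow> simple_graph V H" using simple simple_graph_subset by blast

lemma fin_reach: "H \<subseteq> E \<Longrightarrow> finite (reach H A X)" using finite_reach finite_V simple_sub by blast

definition new_nbrs where "new_nbrs a X = {b \<in> V - X. {a, b} \<in> E}"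

lemma finite_new_nbrs: "finite (new_nbrs a X)" by (simp add: new_nbrs_def finite_V)

lemma card_new_nbrs: "card (new_nbrs a X) \<le> degree E a"
proof -
  have "finite {b. {a, b} \<in> E}"
    by (rule finite_subset[OF _ finite_V]) (use simple_graph_edgeD[OF simple] in blast)
  then have "card (new_nbrs a X) \<le> card {b. {a, b} \<in> E}"
    by (intro card_mono) (auto simp: new_nbrs_def)
  then show ?thesis using card_neighbours_le_degree[OF finite_E, of a] by simp
qed

lemma card_new_nbrs_low: "a \<in> V - S \<Longrightarrow> real (card (new_nbrs a X)) \<le> \<Delta>"
  using card_new_nbrs[of a X] low_degree[of a] by linarith

lemma first_neighbour:
  assumes "H \<subseteq> E"
  shows "{b. b \<notin> X \<and> {a, b} \<in> H} = {b \<in> new_nbrs a X. {a, b} \<in> H}"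
  unfolding new_nbrs_def using assms simple_graph_edgeD[OF simple] by blast

text \<open>The exploration of a single low vertex is dominated by a branching process with mean \<open>\<rho>\<close>, whose
  expected progeny is \<open>\<rho> + \<rho>\<^sup>2 + \<dots> = \<rho> / (1 - \<rho>)\<close>. The induction is over the number of unseen vertices:
  each of the at most \<open>\<Delta>\<close> new neighbours \<open>b\<close> contributes itself and its own exploration, at the
  price of one more required edge \<open>{a, b}\<close>. That edge is not in \<open>F\<close>, since \<open>F\<close> only joins seen vertices, and
  so costs a factor \<open>p\<close>. The fixed-point equation \<open>r = \<rho> (1 + r)\<close> closes the induction.\<close>

lemma mean_reach:
  assumes "a \<in> V - S" "a \<in> X" "S \<subseteq> X" "F \<subseteq> E" "F \<subseteq> Pow X" "\<rho> < 1"
  shows "mean E p (\<lambda>H. of_bool (F \<subseteq> H) * real (card (reach H {a} X))) \<le> p ^ card F * (\<rho> / (1 - \<rho>))"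
  using assms
proof (induction "card (V - X)" arbitrary: a X F rule: less_induct)
  case less
  let ?B = "new_nbrs a X"
  let ?F = "\<lambda>b. insert {a, b} F"
  let ?R = "\<lambda>H b. real (card (reach H {b} (insert b X)))"
  have F_card: "card (?F b) = Suc (card F)" and F_sub: "?F b \<subseteq> E" "?F b \<subseteq> Pow (insert b X)"
    and b_V: "b \<in> V - S" if "b \<in> ?B" for b
  proof -
    have "finite F" using less.prems(4) finite_E finite_subset by blast
    moreover have "{a, b} \<notin> F" using that less.prems(5) by (auto simp: new_nbrs_def)
    ultimately show "card (?F b) = Suc (card F)" by simp
    show "?F b \<subseteq> E" "?F b \<subseteq> Pow (insert b X)" "b \<in> V - S"
      using that less.prems by (auto simp: new_nbrs_def)
  qed
  have IH: "mean E p (\<lambda>H. of_bool (?F b \<subseteq> H) * ?R H b) \<le> p ^ Suc (card F) * (\<rho> / (1 - \<rho>))"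
    if b: "b \<in> ?B" for b
  proof -
    have "card (V - insert b X) < card (V - X)"
      using b finite_V by (intro psubset_card_mono) (auto simp: new_nbrs_def)
    then have "mean E p (\<lambda>H. of_bool (?F b \<subseteq> H) * ?R H b) \<le> p ^ card (?F b) * (\<rho> / (1 - \<rho>))"
      by (rule less.hyps) (use b F_sub b_V less.prems in auto)
    then show ?thesis using F_card[OF b] by simp
  qed
  have pw: "of_bool (F \<subseteq> H) * real (card (reach H {a} X))
      \<le> (\<Sum>b\<in>?B. of_bool (?F b \<subseteq> H) + of_bool (?F b \<subseteq> H) * ?R H b)" if H: "H \<subseteq> E" for H
  proof (cases "F \<subseteq> H")
    case True
    let ?BH = "{b \<in> ?B. {a, b} \<in> H}"
    have "card (reach H {a} X) \<le> card (\<Union>b\<in>?BH. insert b (reach H {b} (insert b X)))"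
      using reach_by_first_vertex[of H "{a}" X] first_neighbour[OF H, of X a]
      by (intro card_mono) (auto simp: finite_new_nbrs fin_reach[OF H])
    also have "\<dots> \<le> (\<Sum>b\<in>?BH. card (insert b (reach H {b} (insert b X))))"
      by (rule card_UN_le) (simp add: finite_new_nbrs)
    also have "\<dots> \<le> (\<Sum>b\<in>?BH. 1 + card (reach H {b} (insert b X)))"
      by (intro sum_mono) (simp add: card_insert_le_m1 fin_reach[OF H] card_insert_if)
    finally have "real (card (reach H {a} X)) \<le> (\<Sum>b\<in>?BH. 1 + ?R H b)"
      by (metis (mono_tags, lifting) of_nat_le_iff of_nat_sum of_nat_add of_nat_1 sum.cong)
    also have "\<dots> = (\<Sum>b\<in>?B. of_bool (?F b \<subseteq> H) + of_bool (?F b \<subseteq> H) * ?R H b)"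
      using True by (intro sum.mono_neutral_cong_left) (auto simp: finite_new_nbrs)
    finally show ?thesis using True by simp
  qed (auto intro!: sum_nonneg)
  have "mean E p (\<lambda>H. of_bool (F \<subseteq> H) * real (card (reach H {a} X)))
      \<le> mean E p (\<lambda>H. \<Sum>b\<in>?B. of_bool (?F b \<subseteq> H) + of_bool (?F b \<subseteq> H) * ?R H b)"
    by (rule mean_mono[OF finite_E pw])
  also have "\<dots> = (\<Sum>b\<in>?B. mean E p (\<lambda>H. of_bool (?F b \<subseteq> H))
                        + mean E p (\<lambda>H. of_bool (?F b \<subseteq> H) * ?R H b))"
    by (simp add: mean_sum mean_add finite_E)
  also have "\<dots> \<le> (\<Sum>b\<in>?B. p ^ Suc (card F) + p ^ Suc (card F) * (\<rho> / (1 - \<rho>)))"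
  proof (intro sum_mono add_mono IH)
    fix b assume b: "b \<in> ?B"
    show "mean E p (\<lambda>H. of_bool (?F b \<subseteq> H)) \<le> p ^ Suc (card F)"
      using mean_edges_kept[OF finite_E F_sub(1)[OF b] p_bounds] F_card[OF b] by simp
  qed
  also have "\<dots> = real (card ?B) * (p ^ card F * (p * (1 / (1 - \<rho>))))"
    using less.prems(6) by (simp add: field_simps)
  also have "\<dots> \<le> \<Delta> * (p ^ card F * (p * (1 / (1 - \<rho>))))"
    by (intro mult_right_mono card_new_nbrs_low less.prems(1)) (use p_bounds less.prems(6) in auto)
  also have "\<dots> = p ^ card F * (\<rho> / (1 - \<rho>))" by simp
  finally show ?case .
qed

text \<open>A first-moment bound over the ways in which an exploration with active set \<open>A\<close> can find \<open>m\<close>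
  vertices. To find \<open>m + 1\<close> vertices from \<open>insert a A\<close>, either \<open>a\<close> has no unseen neighbour and can be
  dropped, or one of its at most \<open>\<Delta>\<close> unseen neighbours becomes seen and active, again at the price of one
  new required edge. Writing \<open>W m l\<close> for the bound with \<open>l\<close> active vertices, this is the recurrence
  \<open>W (m + 1) (l + 1) \<le> W (m + 1) l + \<rho> W m (l + 2)\<close>, and \<open>W m l = 2\<^sup>l (4 \<rho>)\<^sup>m\<close> solves it with equality:
  both terms on the right are \<open>2\<^sup>l (4 \<rho>)\<^sup>m\<^sup>+\<^sup>1\<close>.\<close>

lemma prob_reach_ge:
  assumes "A \<subseteq> V - S" "A \<subseteq> X" "S \<subseteq> X" "F \<subseteq> E" "F \<subseteq> Pow X"
  shows "mean E p (\<lambda>H. of_bool (F \<subseteq> H \<and> m \<le> card (reach H A X)))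
           \<le> p ^ card F * (2 ^ card A * (4 * \<rho>) ^ m)"
  using assms
proof (induction m arbitrary: A X F)
  case 0
  have "p ^ card F * 1 \<le> p ^ card F * 2 ^ card A"
    using p_bounds by (intro mult_left_mono) auto
  then show ?case using mean_edges_kept[OF finite_E 0(4) p_bounds] by simp
next
  case (Suc m)
  have "finite A" using Suc.prems(1) finite_V finite_subset by blast
  then show ?case using Suc.prems(1,2)
  proof (induction A rule: finite_induct)
    case empty
    then show ?case using p_bounds rho_nonneg by (simp add: reach_empty \<Delta>_nonneg)
  next
    case (insert a A)
    let ?B = "new_nbrs a X"
    let ?F = "\<lambda>b. insert {a, b} F"
    let ?P = "\<lambda>H b. ?F b \<subseteq> H \<and> m \<le> card (reach H (insert b (insert a A)) (insert b X))"
    have a: "a \<in> V - S" "a \<in> X" using insert.prems by auto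
    have IH: "mean E p (\<lambda>H. of_bool (?P H b)) \<le> p ^ Suc (card F) * (2 ^ (card A + 2) * (4 * \<rho>) ^ m)"
      if b: "b \<in> ?B" for b
    proof -
      have "finite F" using Suc.prems(4) finite_E finite_subset by blast
      moreover have "{a, b} \<notin> F" using b Suc.prems(5) by (auto simp: new_nbrs_def)
      ultimately have cF: "card (?F b) = Suc (card F)" by simp
      have "b \<notin> insert a A" using b insert.prems by (auto simp: new_nbrs_def)
      then have cA: "card (insert b (insert a A)) = card A + 2"
        using insert.hyps by simp
      have "mean E p (\<lambda>H. of_bool (?P H b))
          \<le> p ^ card (?F b) * (2 ^ card (insert b (insert a A)) * (4 * \<rho>) ^ m)"
        by (rule Suc.IH) (use b insert.prems Suc.prems(3-5) in \<open>auto simp: new_nbrs_def\<close>)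
      then show ?thesis unfolding cF cA .
    qed
    have pw: "of_bool (F \<subseteq> H \<and> Suc m \<le> card (reach H (insert a A) X))
        \<le> of_bool (F \<subseteq> H \<and> Suc m \<le> card (reach H A X)) + (\<Sum>b\<in>?B. of_bool (?P H b) :: real)"
      if H: "H \<subseteq> E" for H
    proof (cases "F \<subseteq> H \<and> Suc m \<le> card (reach H (insert a A) X)")
      case True
      show ?thesis
      proof (cases "\<exists>b. b \<notin> X \<and> {a, b} \<in> H")
        case False
        then have "reach H (insert a A) X \<subseteq> reach H A X" by (intro reach_skip) blast
        then have "Suc m \<le> card (reach H A X)"
          using True card_mono[OF fin_reach[OF H]] by (meson order_trans)
        then show ?thesis using True by (simp add: sum_nonneg)
      next
        case ex: True
        then obtain b where b: "b \<in> ?B" "{a, b} \<in> H"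
          using first_neighbour[OF H, of X a] by blast
        have "card (reach H (insert a A) X)
            \<le> card (insert b (reach H (insert b (insert a A)) (insert b X)))"
          by (intro card_mono reach_reveal) (simp add: fin_reach[OF H])
        also have "\<dots> \<le> Suc (card (reach H (insert b (insert a A)) (insert b X)))"
          by (simp add: fin_reach[OF H] card_insert_if)
        finally have "?P H b" using True b by auto
        then have "1 \<le> (of_bool (?P H b) :: real)" by simp
        also have "\<dots> \<le> (\<Sum>b\<in>?B. of_bool (?P H b) :: real)"
          by (rule member_le_sum[OF b(1)]) (auto simp: finite_new_nbrs)
        finally show ?thesis using True by simp
      qed
    next
      case False
      then have zero: "of_bool (F \<subseteq> H \<and> Suc m \<le> card (reach H (insert a A) X)) = (0 :: real)"
        by (simp only: of_bool_eq_0_iff not_False_eq_True)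
      show ?thesis unfolding zero by (intro add_nonneg_nonneg sum_nonneg) auto
    qed
    have "mean E p (\<lambda>H. of_bool (F \<subseteq> H \<and> Suc m \<le> card (reach H (insert a A) X)))
        \<le> mean E p (\<lambda>H. of_bool (F \<subseteq> H \<and> Suc m \<le> card (reach H A X)) + (\<Sum>b\<in>?B. of_bool (?P H b)))"
      by (rule mean_mono[OF finite_E pw])
    also have "\<dots> = mean E p (\<lambda>H. of_bool (F \<subseteq> H \<and> Suc m \<le> card (reach H A X)))
        + (\<Sum>b\<in>?B. mean E p (\<lambda>H. of_bool (?P H b)))"
      by (simp only: mean_sum mean_add finite_E)
    also have "\<dots> \<le> p ^ card F * (2 ^ card A * (4 * \<rho>) ^ Suc m)
        + (\<Sum>b\<in>?B. p ^ Suc (card F) * (2 ^ (card A + 2) * (4 * \<rho>) ^ m))"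
      by (intro add_mono sum_mono IH insert.IH) (use insert.prems in auto)
    also have "\<dots> = p ^ card F * (2 ^ card A * (4 * \<rho>) ^ Suc m)
        + real (card ?B) * (p ^ Suc (card F) * (2 ^ (card A + 2) * (4 * \<rho>) ^ m))" by simp
    also have "\<dots> \<le> p ^ card F * (2 ^ card A * (4 * \<rho>) ^ Suc m)
        + \<Delta> * (p ^ Suc (card F) * (2 ^ (card A + 2) * (4 * \<rho>) ^ m))"
      by (intro add_left_mono mult_right_mono card_new_nbrs_low a) (use p_bounds rho_nonneg in auto)
    also have "\<dots> = p ^ card F * (2 ^ card (insert a A) * (4 * \<rho>) ^ Suc m)"
      using insert.hyps by (simp add: algebra_simps)
    finally show ?case .
  qed
qed

definition touching :: "'a set set" where "touching = {e \<in> E. e \<inter> S \<noteq> {}}"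

text \<open>An upper bound for the number of vertices outside \<open>S\<close> that are reached from \<open>S\<close> but only after at
  least two steps. A vertex is counted once for every kept edge that leaves \<open>S\<close> and can start such a walk;
  this makes the mean a plain sum. The presence of the edge is written \<open>{{s, b}} \<subseteq> H\<close> so that the
  summands have the form treated by \<open>mean_reach\<close>.\<close>

definition far :: "'a set set \<Rightarrow> real" where
  "far H = (\<Sum>s\<in>S. \<Sum>b\<in>new_nbrs s S. of_bool ({{s, b}} \<subseteq> H) * real (card (reach H {b} (insert b S))))"

lemma finite_S: "finite S" using S_subset finite_V finite_subset by blast

lemma mean_far:
  assumes "\<rho> < 1"
  shows "mean E p far \<le> \<mu> * (\<rho> / (1 - \<rho>))"
proof -
  have x1: "0 \<le> p * (\<rho> / (1 - \<rho>))" using rho_nonneg assms p_bounds by simp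
  have "mean E p far = (\<Sum>s\<in>S. \<Sum>b\<in>new_nbrs s S.
      mean E p (\<lambda>H. of_bool ({{s, b}} \<subseteq> H) * real (card (reach H {b} (insert b S)))))"
    unfolding far_def by (simp only: mean_sum finite_E)
  also have "\<dots> \<le> (\<Sum>s\<in>S. \<Sum>b\<in>new_nbrs s S. p ^ card {{s, b}} * (\<rho> / (1 - \<rho>)))"
    by (intro sum_mono mean_reach) (use assms in \<open>auto simp: new_nbrs_def\<close>)
  also have "\<dots> = (\<Sum>s\<in>S. real (card (new_nbrs s S)) * (p * (\<rho> / (1 - \<rho>))))" by simp
  also have "\<dots> \<le> (\<Sum>s\<in>S. real (degree E s) * (p * (\<rho> / (1 - \<rho>))))"
    by (intro sum_mono mult_right_mono x1) (simp add: card_new_nbrs)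
  also have "\<dots> = real (degree_sum (degree E) S) * (p * (\<rho> / (1 - \<rho>)))"
    by (simp only: degree_sum_def of_nat_sum sum_distrib_right)
  finally show ?thesis by (simp add: mult_ac)
qed

lemma card_reach_S:
  assumes H: "H \<subseteq> E"
  shows "real (card (reach H S S)) \<le> real (card (H \<inter> touching)) + far H"
proof -
  let ?N = "\<lambda>s. {b \<in> new_nbrs s S. {s, b} \<in> H}"
  let ?near = "{b. b \<notin> S \<and> (\<exists>s\<in>S. {s, b} \<in> H)}"
  let ?far = "\<Union>s\<in>S. \<Union>b\<in>?N s. reach H {b} (insert b S)"
  have fin_near: "finite ?near"
    by (rule finite_subset[OF _ finite_V]) (use H simple_graph_edgeD[OF simple] in blast)
  have fin_far: "finite ?far"
    using finite_S finite_new_nbrs fin_reach[OF H] by auto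
  have "reach H S S \<subseteq> ?near \<union> ?far"
    using reach_by_first_vertex[of H S S] reach_subset[OF simple_sub[OF H], of S S]
    by (auto simp: first_neighbour[OF H])
  then have "card (reach H S S) \<le> card (?near \<union> ?far)"
    by (rule card_mono[rotated]) (use fin_near fin_far in blast)
  also have "\<dots> \<le> card ?near + card ?far" by (rule card_Un_le)
  also have "card ?near \<le> card (H \<inter> touching)"
  proof -
    have "{e \<in> H. e \<inter> S \<noteq> {}} = H \<inter> touching" using H by (auto simp: touching_def)
    then show ?thesis using card_boundary[OF finite_V simple_sub[OF H], of S] by simp
  qed
  also have "card ?far \<le> (\<Sum>s\<in>S. card (\<Union>b\<in>?N s. reach H {b} (insert b S)))"
    by (rule card_UN_le[OF finite_S])
  also have "\<dots> \<le> (\<Sum>s\<in>S. \<Sum>b\<in>?N s. card (reach H {b} (insert b S)))"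
    by (intro sum_mono card_UN_le) (simp add: finite_new_nbrs)
  finally have "real (card (reach H S S)) \<le> real (card (H \<inter> touching))
      + (\<Sum>s\<in>S. \<Sum>b\<in>?N s. real (card (reach H {b} (insert b S))))"
    by (simp flip: of_nat_sum of_nat_add)
  also have "(\<Sum>s\<in>S. \<Sum>b\<in>?N s. real (card (reach H {b} (insert b S)))) = far H"
    unfolding far_def
    by (intro sum.cong sum.mono_neutral_cong_left refl) (auto simp: finite_new_nbrs)
  finally show ?thesis .
qed

text \<open>The excess \<open>2 \<delta> \<mu>\<close> is divided equally between the kept edges that touch \<open>S\<close> and the far
  vertices.\<close>

lemma large_component_cause:
  assumes H: "H \<subseteq> E" and "V \<noteq> {}"
    and large: "real (card S) + (1 + 2 * \<delta>) * \<mu> < real (L1 V H)" "j < L1 V H"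
  shows "(1 + \<delta>) * \<mu> < real (card (H \<inter> touching)) \<or> \<delta> * \<mu> < far H
    \<or> (\<exists>v\<in>V - S. j \<le> card (reach H {v} (insert v S)))"
proof -
  have "L1 V H \<in> (\<lambda>v. card (component_of H v)) ` V"
    unfolding L1_def using finite_V assms(2) by (intro Max_in) auto
  then obtain v where v: "v \<in> V" "L1 V H = card (component_of H v)" by blast
  show ?thesis
  proof (cases "component_of H v \<inter> S = {}")
    case True
    have "v \<in> component_of H v" by (simp add: component_of_def)
    then have "v \<in> V - S" using True v(1) by blast
    have "card (component_of H v) \<le> card (insert v (reach H {v} (insert v S)))"
      by (intro card_mono component_of_avoids[OF True]) (simp add: fin_reach[OF H])
    also have "\<dots> \<le> Suc (card (reach H {v} (insert v S)))"
      by (simp add: fin_reach[OF H] card_insert_if)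
    finally have "j \<le> card (reach H {v} (insert v S))" using large(2) v(2) by simp
    then show ?thesis using \<open>v \<in> V - S\<close> by blast
  next
    case False
    have "card (component_of H v) \<le> card (S \<union> reach H S S)"
      by (intro card_mono component_of_meets[OF False]) (simp add: fin_reach[OF H] finite_S)
    also have "\<dots> \<le> card S + card (reach H S S)" by (rule card_Un_le)
    finally have "real (L1 V H) \<le> real (card S) + (real (card (H \<inter> touching)) + far H)"
      using card_reach_S[OF H] v(2) by linarith
    then have "(1 + \<delta>) * \<mu> + \<delta> * \<mu> < real (card (H \<inter> touching)) + far H"
      using large(1) by (simp add: algebra_simps)
    then show ?thesis by linarith
  qed
qed

text \<open>The three terms are the errors from Chebyshev's inequality for the edges at \<open>S\<close>, from Markov's
  inequality for the far vertices, and from the union bound over the components that avoid \<open>S\<close>.\<close>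

lemma prob_L1_large:
  assumes "V \<noteq> {}" "0 < \<delta>" "0 < \<mu>" "\<rho> < 1"
  shows "measure_pmf.prob (random_subgraph E p)
           {H. real (card S) + (1 + 2 * \<delta>) * \<mu> < real (L1 V H) \<and> j < L1 V H}
         \<le> 1 / (\<delta>\<^sup>2 * \<mu>) + \<rho> / (1 - \<rho>) / \<delta> + 2 * real (card V) * (4 * \<rho>) ^ j"
proof -
  let ?bad = "\<lambda>H. real (card S) + (1 + 2 * \<delta>) * \<mu> < real (L1 V H) \<and> j < L1 V H"
  let ?dev = "\<lambda>H. (real (card (H \<inter> touching)) - real (card touching) * p)\<^sup>2"
  let ?big = "\<lambda>v H. {} \<subseteq> H \<and> j \<le> card (reach H {v} (insert v S))"
  have "card touching \<le> degree_sum (degree E) S"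
    unfolding touching_def by (rule card_edges_touching[OF finite_E finite_S])
  then have "real (card touching) * p \<le> real (degree_sum (degree E) S) * p"
    using p_bounds by (intro mult_right_mono) auto
  then have T: "touching \<subseteq> E" "real (card touching) * p \<le> \<mu>"
    by (auto simp: touching_def mult.commute)
  have c: "0 < \<delta> * \<mu>" "0 < (\<delta> * \<mu>)\<^sup>2"
    using mult_pos_pos[OF assms(2,3)] zero_less_power by blast+
  have far0: "0 \<le> far H" for H unfolding far_def by (intro sum_nonneg) auto
  \<comment> \<open>The indicator of the bad event lies below the sum of three random variables with small means;
    this is Chebyshev, Markov and the union bound in a single step.\<close>
  have pw: "of_bool (?bad H) \<le> ?dev H / (\<delta> * \<mu>)\<^sup>2 + (far H / (\<delta> * \<mu>) + (\<Sum>v\<in>V - S. of_bool (?big v H)))"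
    if H: "H \<subseteq> E" for H
  proof (cases "?bad H")
    case True
    have nn: "0 \<le> ?dev H / (\<delta> * \<mu>)\<^sup>2" "0 \<le> far H / (\<delta> * \<mu>)"
        "0 \<le> (\<Sum>v\<in>V - S. of_bool (?big v H) :: real)"
      using c far0[of H] by (auto intro!: sum_nonneg)
    consider "(1 + \<delta>) * \<mu> < real (card (H \<inter> touching))" | "\<delta> * \<mu> < far H"
      | v where "v \<in> V - S" "j \<le> card (reach H {v} (insert v S))"
      using large_component_cause[OF H assms(1), of \<delta> j] True by blast
    then have "1 \<le> ?dev H / (\<delta> * \<mu>)\<^sup>2 \<or> 1 \<le> far H / (\<delta> * \<mu>)
        \<or> 1 \<le> (\<Sum>v\<in>V - S. of_bool (?big v H) :: real)"
    proof cases
      case 1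
      then have "\<delta> * \<mu> \<le> real (card (H \<inter> touching)) - real (card touching) * p"
        using T(2) by (simp add: algebra_simps)
      then have "(\<delta> * \<mu>)\<^sup>2 \<le> ?dev H" using c(1) by (intro power_mono) auto
      then show ?thesis using c(2) by (simp add: le_divide_eq)
    next
      case 2
      then show ?thesis using c(1) by (simp add: le_divide_eq)
    next
      case 3
      then have "of_bool (?big v H) \<le> (\<Sum>v\<in>V - S. of_bool (?big v H) :: real)"
        using finite_V by (intro member_le_sum) auto
      then show ?thesis using 3 by simp
    qed
    moreover have "of_bool (?bad H) = (1 :: real)" by (simp only: of_bool_eq_1_iff True)
    ultimately show ?thesis using nn by linarith
  next
    case False
    then show ?thesis using c far0[of H] by (auto intro!: add_nonneg_nonneg sum_nonneg)
  qed
  have dev: "mean E p ?dev \<le> \<mu>"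
  proof -
    have "mean E p ?dev = (real (card touching) * p) * (1 - p)"
      by (simp add: variance_edges_kept[OF finite_E T(1) p_bounds])
    also have "\<dots> \<le> (real (card touching) * p) * 1"
      using p_bounds by (intro mult_left_mono) auto
    finally show ?thesis using T(2) by simp
  qed
  have big: "mean E p (\<lambda>H. of_bool (?big v H)) \<le> 2 * (4 * \<rho>) ^ j" if "v \<in> V - S" for v
    using prob_reach_ge[of "{v}" "insert v S" "{}" j] that by auto
  have cancel: "m / (\<delta> * m)\<^sup>2 = 1 / (\<delta>\<^sup>2 * m)" "m * a / (\<delta> * m) = a / \<delta>" if "0 < m" for m a :: real
    using that assms(2) by (simp_all add: power2_eq_square)
  have "measure_pmf.prob (random_subgraph E p) {H. ?bad H} = mean E p (\<lambda>H. of_bool (?bad H))"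
    by (rule prob_eq_mean)
  also have "\<dots> \<le> mean E p (\<lambda>H. ?dev H / (\<delta> * \<mu>)\<^sup>2
      + (far H / (\<delta> * \<mu>) + (\<Sum>v\<in>V - S. of_bool (?big v H))))"
    by (rule mean_mono[OF finite_E pw])
  also have "\<dots> = mean E p ?dev / (\<delta> * \<mu>)\<^sup>2
      + (mean E p far / (\<delta> * \<mu>) + (\<Sum>v\<in>V - S. mean E p (\<lambda>H. of_bool (?big v H))))"
    by (simp only: mean_add mean_sum finite_E Bochner_Integration.integral_divide_zero)
  also have "\<dots> \<le> \<mu> / (\<delta> * \<mu>)\<^sup>2
      + (\<mu> * (\<rho> / (1 - \<rho>)) / (\<delta> * \<mu>) + (\<Sum>v\<in>V - S. 2 * (4 * \<rho>) ^ j))"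
    by (intro add_mono divide_right_mono dev mean_far sum_mono big) (use assms c in auto)
  also have "\<mu> / (\<delta> * \<mu>)\<^sup>2 = 1 / (\<delta>\<^sup>2 * \<mu>)" by (rule cancel(1)[OF assms(3)])
  also have "\<mu> * (\<rho> / (1 - \<rho>)) / (\<delta> * \<mu>) = \<rho> / (1 - \<rho>) / \<delta>" by (rule cancel(2)[OF assms(3)])
  also have "(\<Sum>v\<in>V - S. 2 * (4 * \<rho>) ^ j) \<le> 2 * real (card V) * (4 * \<rho>) ^ j"
    using card_mono[OF finite_V, of "V - S"] rho_nonneg
    by (auto simp: intro!: mult_right_mono)
  finally show ?thesis by simp
qed

end

section \<open>Passing to the limit\<close>

text \<open>Put \<open>r = 2 log n / log w\<close>, so that \<open>w\<^sup>r = n\<^sup>2\<close>. Rounding \<open>r\<close> down to \<open>j\<close> could cost a whole factor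
  \<open>w\<close>, which may be nearly as large as \<open>n\<close>. But \<open>w \<le> n\<close> gives \<open>r \<ge> 2\<close>, hence \<open>j \<ge> 2\<close> and
  \<open>j \<ge> 2 r / 3\<close>, since \<open>r < j + 1 \<le> 3 j / 2\<close>. Also \<open>4 \<le> w\<^sup>1\<^sup>/\<^sup>8\<close>, so
  \<open>(4 / w)\<^sup>j \<le> w\<^sup>-\<^sup>(\<^sup>7\<^sup>/\<^sup>8\<^sup>)\<^sup>(\<^sup>2\<^sup>/\<^sup>3\<^sup>)\<^sup>r = n\<^sup>-\<^sup>7\<^sup>/\<^sup>6\<close>, which beats the factor \<open>n\<close>.\<close>

lemma subcritical_tail:
  fixes n w \<rho> :: real
  assumes "4 ^ 8 \<le> w" "w \<le> n" "0 \<le> \<rho>" "\<rho> \<le> 1 / w"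
  shows "n * (4 * \<rho>) ^ nat \<lfloor>2 * (ln n / ln w)\<rfloor> \<le> n powr (- 1 / 6)"
proof -
  define r where "r = 2 * (ln n / ln w)"
  define j where "j = nat \<lfloor>r\<rfloor>"
  have w: "1 < w" "0 < w" "0 < n" using assms(1,2) by auto
  have "ln w \<le> ln n" using assms(2) w by simp
  then have r2: "2 \<le> r" using w by (simp add: r_def le_divide_eq)
  then have "2 \<le> \<lfloor>r\<rfloor>" by (simp add: le_floor_iff)
  then have "2 \<le> j" unfolding j_def by linarith
  moreover have "r < real j + 1" using r2 unfolding j_def by linarith
  ultimately have jr: "2 / 3 * r \<le> real j" by linarith
  have "4 = (4 ^ 8) powr (1 / 8 :: real)" by (simp add: powr_powr flip: powr_numeral)
  also have "\<dots> \<le> w powr (1 / 8)" using assms(1) by (intro powr_mono2) auto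
  finally have "4 / w \<le> w powr (1 / 8) / w" using w by (intro divide_right_mono) auto
  also have "\<dots> = w powr (1 / 8 - 1)" using w by (simp only: powr_diff powr_one)
  finally have "4 * \<rho> \<le> w powr (- 7 / 8)" using assms(4) by simp
  then have "(4 * \<rho>) ^ j \<le> (w powr (- 7 / 8)) ^ j" using assms(3) by (intro power_mono) auto
  also have "\<dots> = w powr (- 7 / 8 * real j)" using w by (simp add: powr_powr flip: powr_realpow)
  also have "\<dots> \<le> w powr (- 7 / 8 * (2 / 3 * r))" using w jr by (intro powr_mono) auto
  also have "\<dots> = n powr (- 7 / 6)" using w by (simp add: powr_def r_def)
  finally have "n * (4 * \<rho>) ^ j \<le> n powr 1 * n powr (- 7 / 6)" using w by simp
  also have "\<dots> = n powr (- 1 / 6)" by (simp only: powr_add[symmetric]) simp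
  finally show ?thesis unfolding j_def r_def .
qed

lemma L1_le_card:
  assumes "finite V" "V \<noteq> {}" "simple_graph V H"
  shows "L1 V H \<le> card V"
proof -
  have "card (component_of H v) \<le> card V" if "v \<in> V" for v
    using that simple_graph_edgeD[OF assms(3)] assms(1)
    by (intro card_mono component_of_closed) auto
  then show ?thesis unfolding L1_def using assms(1,2) by (subst Max_le_iff) auto
qed

text \<open>The finite form of the theorem. For \<open>w > |V|\<close> the first term of the maximum already exceeds the
  number of vertices; otherwise \<open>prob_L1_large\<close> applies with \<open>\<delta> = w\<^sup>-\<^sup>1\<^sup>/\<^sup>3\<close>, for which
  the failure probability \<open>1 / (\<delta>\<^sup>2 w)\<close> from Chebyshev's inequality is as small as the precision \<open>\<delta>\<close>.\<close>

lemma (in percolation) prob_L1_bound: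
  assumes "V \<noteq> {}" "4 ^ 8 \<le> w" "\<rho> \<le> 1 / w" "w \<le> \<mu>"
  shows "1 - (3 * w powr (- 1 / 3) + 2 * real (card V) powr (- 1 / 6))
    \<le> measure_pmf.prob (random_subgraph E p)
        {H. real (L1 V H) \<le> max (real (card S) + (1 + 2 * w powr (- 1 / 3)) * \<mu>)
                                 (2 * (ln (real (card V)) / ln w))}"
    (is "1 - ?err \<le> measure_pmf.prob ?M {H. ?good H}")
proof (cases "w \<le> real (card V)")
  case False
  have "?good H" if "H \<subseteq> E" for H
  proof -
    have "real (L1 V H) \<le> real (card V)"
      using L1_le_card[OF finite_V assms(1) simple_sub[OF that]] by simp
    also have "\<dots> \<le> 1 * \<mu>" using False assms(4) by linarith
    also have "\<dots> \<le> (1 + 2 * w powr (- 1 / 3)) * \<mu>"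
      using p_bounds by (intro mult_right_mono) auto
    finally show ?thesis by linarith
  qed
  then have "measure_pmf.prob ?M {H. ?good H} = 1"
    using set_random_subgraph[of E p] by (subst measure_pmf.prob_eq_1) (auto simp: AE_measure_pmf_iff)
  moreover have "0 \<le> ?err" by (intro add_nonneg_nonneg mult_nonneg_nonneg) auto
  ultimately show ?thesis by linarith
next
  case True
  define \<delta> where "\<delta> = w powr (- 1 / 3)"
  define r where "r = 2 * (ln (real (card V)) / ln w)"
  define j where "j = nat \<lfloor>r\<rfloor>"
  let ?bad = "\<lambda>H. real (card S) + (1 + 2 * \<delta>) * \<mu> < real (L1 V H) \<and> j < L1 V H"
  have w: "4 ^ 8 \<le> w" "0 < w" "2 \<le> w" "1 < w" using assms(2) by auto
  have "1 / w \<le> 1 / 2" using w by (simp add: field_simps)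
  then have rho_half: "\<rho> \<le> 1 / 2" using assms(3) by linarith
  have \<delta>: "0 < \<delta>" using w by (simp add: \<delta>_def)
  have \<mu>: "0 < \<mu>" using w assms(4) by linarith
  have cube: "\<delta>\<^sup>2 * w = 1 / \<delta>" "1 / w = \<delta> ^ 3"
  proof -
    have "\<delta> ^ 3 = w powr (- 1)" unfolding \<delta>_def using w by (simp add: powr_powr flip: powr_realpow)
    then show c: "1 / w = \<delta> ^ 3" using w by (simp add: powr_minus_divide)
    show "\<delta>\<^sup>2 * w = 1 / \<delta>" using c w \<delta> by (simp add: field_simps power3_eq_cube power2_eq_square)
  qed
  have "w powr (- 1 / 3) \<le> w powr 0" using w by (intro powr_mono) auto
  then have \<delta>1: "\<delta> \<le> 1" using w by (simp add: \<delta>_def)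
  have t1: "1 / (\<delta>\<^sup>2 * \<mu>) \<le> \<delta>"
  proof -
    have "1 / (\<delta>\<^sup>2 * m) \<le> 1 / (\<delta>\<^sup>2 * w)" if "w \<le> m" for m
      using \<delta> w that by (intro divide_left_mono mult_left_mono mult_pos_pos) auto
    from this[OF assms(4)] show ?thesis using cube by simp
  qed
  have t2: "\<rho> / (1 - \<rho>) / \<delta> \<le> 2 * \<delta>"
  proof -
    have "\<rho> / (1 - \<rho>) \<le> \<rho> / (1 / 2)" using rho_half rho_nonneg by (intro divide_left_mono) auto
    also have "\<dots> \<le> 2 * \<delta> ^ 3" using assms(3) cube by simp
    also have "\<dots> \<le> 2 * \<delta>\<^sup>2" using \<delta> \<delta>1 by (simp add: power_decreasing)
    finally have "\<rho> / (1 - \<rho>) \<le> (2 * \<delta>) * \<delta>" by (simp only: power2_eq_square mult.assoc)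
    then show ?thesis by (simp only: pos_divide_le_eq[OF \<delta>])
  qed
  have t3: "2 * real (card V) * (4 * \<rho>) ^ j \<le> 2 * real (card V) powr (- 1 / 6)"
    using subcritical_tail[OF w(1) True rho_nonneg assms(3)] by (simp add: j_def r_def)
  have "0 \<le> r" using w True by (simp add: r_def)
  then have jr: "real j \<le> r" unfolding j_def by linarith
  have "measure_pmf.prob ?M {H. ?bad H}
      \<le> 1 / (\<delta>\<^sup>2 * \<mu>) + \<rho> / (1 - \<rho>) / \<delta> + 2 * real (card V) * (4 * \<rho>) ^ j"
    by (rule prob_L1_large) (use assms(1) \<delta> \<mu> rho_half in auto)
  also have "\<dots> \<le> ?err" using t1 t2 t3 by (simp add: \<delta>_def)
  finally have "1 - ?err \<le> 1 - measure_pmf.prob ?M {H. ?bad H}" by simp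
  also have "\<dots> = measure_pmf.prob ?M (space ?M - {H. ?bad H})"
    by (subst measure_pmf.prob_compl) auto
  also have "\<dots> \<le> measure_pmf.prob ?M {H. ?good H}"
  proof (rule measure_pmf.finite_measure_mono)
    show "space ?M - {H. ?bad H} \<subseteq> {H. ?good H}"
    proof
      fix H assume "H \<in> space ?M - {H. ?bad H}"
      then have "real (L1 V H) \<le> real (card S) + (1 + 2 * \<delta>) * \<mu> \<or> real (L1 V H) \<le> real j"
        by (auto simp: not_less)
      then show "H \<in> {H. ?good H}" using jr unfolding \<delta>_def r_def by auto
    qed
  qed simp
  finally show ?thesis .
qed

theorem theorem1p10:
  fixes D :: "nat \<Rightarrow> nat \<Rightarrow> nat"
    and d p \<omega> :: "nat \<Rightarrow> real"
    and G :: "nat \<Rightarrow> nat set set"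
  assumes D_pos: "\<And>n v. n \<ge> 2 \<Longrightarrow> v \<in> {1..n} \<Longrightarrow> D n v \<ge> 1"
    and D_feasible: "\<And>n. n \<ge> 2 \<Longrightarrow> feasible n (D n)"
    and d_pos: "\<And>n. n \<ge> 2 \<Longrightarrow> d n > 0"
    and p_range: "\<And>n. n \<ge> 2 \<Longrightarrow> 0 < p n \<and> p n \<le> 1"
    and p_small: "p \<in> o(\<lambda>n. 1 / d n)"
    and p_large: "(\<lambda>_. 1) \<in> o(\<lambda>n. p n * real (degree_sum (D n) (high_degree n (D n) (d n))))"
    and omega: "\<And>n. \<omega> n = min (1 / (d n * p n))
                        (p n * real (degree_sum (D n) (high_degree n (D n) (d n))))"
    and G_simple: "\<And>n. n \<ge> 2 \<Longrightarrow> simple_graph {1..n} (G n)"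
    and G_degrees: "\<And>n. n \<ge> 2 \<Longrightarrow> has_degrees {1..n} (G n) (D n)"
  shows "(\<lambda>n. measure_pmf.prob (random_subgraph (G n) (p n))
            {H. real (L1 {1..n} H) \<le>
                max (real (card (high_degree n (D n) (d n)))
                      + (1 + 2 * \<omega> n powr (- 1 / 3))
                        * (p n * real (degree_sum (D n) (high_degree n (D n) (d n)))))
                    (2 * (ln (real n) / ln (\<omega> n)))})
         \<longlonglongrightarrow> 1"
proof -
  define S where "S = (\<lambda>n. high_degree n (D n) (d n))"
  define \<mu> where "\<mu> = (\<lambda>n. p n * real (degree_sum (D n) (S n)))"
  let ?P = "\<lambda>n. measure_pmf.prob (random_subgraph (G n) (p n))
          {H. real (L1 {1..n} H) \<le> max (real (card (S n)) + (1 + 2 * \<omega> n powr (- 1 / 3)) * \<mu> n)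
                                        (2 * (ln (real n) / ln (\<omega> n)))}"
  have \<omega>: "\<omega> n = min (1 / (d n * p n)) (\<mu> n)" for n
    using omega by (simp add: \<mu>_def S_def)
  have lim: "filterlim \<omega> at_top sequentially"
    unfolding filterlim_at_top_gt[where c = 0]
  proof (intro allI impI)
    fix Z :: real assume Z: "0 < Z"
    have "\<forall>\<^sub>F n in sequentially. norm (p n) \<le> 1 / Z * norm (1 / d n)"
      using landau_o.smallD[OF p_small, of "1 / Z"] Z by simp
    moreover have "\<forall>\<^sub>F n in sequentially. norm (1 :: real) \<le> 1 / Z * norm (\<mu> n)"
      using landau_o.smallD[OF p_large, of "1 / Z"] Z by (simp add: \<mu>_def S_def)
    ultimately show "\<forall>\<^sub>F n in sequentially. Z \<le> \<omega> n"
      using eventually_ge_at_top[of 2]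
    proof eventually_elim
      case (elim n)
      have pd: "0 < p n" "0 < d n" using p_range d_pos elim(3) by auto
      then have "0 \<le> \<mu> n" by (simp add: \<mu>_def)
      then show ?case using elim(1,2) pd Z unfolding \<omega> by (simp add: field_simps)
    qed
  qed
  have lower: "1 - (3 * \<omega> n powr (- 1 / 3) + 2 * real n powr (- 1 / 6))
      \<le> ?P n"
    if n: "2 \<le> n" "4 ^ 8 \<le> \<omega> n" for n
  proof -
    have deg: "degree (G n) v = D n v" if "v \<in> {1..n}" for v
      using G_degrees[OF n(1)] that by (auto simp: has_degrees_def)
    have S: "S n \<subseteq> {1..n}" by (auto simp: S_def high_degree_def)
    interpret percolation "{1..n}" "S n" "G n" "p n" "d n"
    proof
      show "real (degree (G n) v) \<le> d n" if "v \<in> {1..n} - S n" for v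
        using that deg by (auto simp: S_def high_degree_def)
    qed (use G_simple[OF n(1)] p_range[OF n(1)] d_pos[OF n(1)] S in auto)
    have ds: "degree_sum (degree (G n)) (S n) = degree_sum (D n) (S n)"
      unfolding degree_sum_def using S deg by (intro sum.cong) auto
    have "0 < d n * p n" using d_pos p_range n(1) by simp
    moreover have "\<omega> n \<le> 1 / (d n * p n)" "\<omega> n \<le> \<mu> n" unfolding \<omega> by auto
    ultimately have "d n * p n \<le> 1 / \<omega> n" using n(2) by (simp add: field_simps)
    then show ?thesis
      using prob_L1_bound[of "\<omega> n"] n \<open>\<omega> n \<le> \<mu> n\<close> by (simp add: ds \<mu>_def)
  qed
  have "\<forall>\<^sub>F n in sequentially. 4 ^ 8 \<le> \<omega> n" using lim by (simp add: filterlim_at_top)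
  then have ev: "\<forall>\<^sub>F n in sequentially. 1 - (3 * \<omega> n powr (- 1 / 3) + 2 * real n powr (- 1 / 6))
      \<le> ?P n"
    using eventually_ge_at_top[of 2] by eventually_elim (rule lower)
  have "(\<lambda>n. \<omega> n powr (- 1 / 3)) \<longlonglongrightarrow> 0" by (rule tendsto_neg_powr[OF _ lim]) simp
  moreover have "(\<lambda>n. real n powr (- 1 / 6)) \<longlonglongrightarrow> 0"
    by (rule tendsto_neg_powr[OF _ filterlim_real_sequentially]) simp
  ultimately have "(\<lambda>n. 1 - (3 * \<omega> n powr (- 1 / 3) + 2 * real n powr (- 1 / 6))) \<longlonglongrightarrow> 1 - (3 * 0 + 2 * 0)"
    by (intro tendsto_intros)
  then have err: "(\<lambda>n. 1 - (3 * \<omega> n powr (- 1 / 3) + 2 * real n powr (- 1 / 6))) \<longlonglongrightarrow> 1"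
    by simp
  have "?P \<longlonglongrightarrow> 1" by (rule tendsto_sandwich[OF ev _ err tendsto_const]) simp
  then show ?thesis unfolding \<mu>_def S_def .
qed

end
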